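(* Let $M$ be a measurable space and $T\colon M^{\mathbb{Z}}\to M^{\mathbb{Z}}$ a simple renormalization map with local rule $\varphi\colon M^{2\ell+1}\to M$. Suppose that $\varphi$ has a positional symmetry that moves its central argument (the argument with index $\ell+1$). Let $\underline{X}=(X_k)_{k\in\mathbb{Z}}$ be a sequence of independent and identically distributed random variables with values in $M$, and let $\underline{X}^T$ be the trace of $\underline{X}$ under $T$. Then, for every tail event $E\subseteq M^{\mathbb{N}_0}$, we have $\mathbb{P}(\underline{X}^T\in E)\in\{0,1\}$.
   Context: A map $T\colon M^{\mathbb{Z}}\to M^{\mathbb{Z}}$ is a renormalization map if there exist integers $\ell,r\ge 0$ and a measurable map $\varphi\colon M^{2\ell+2r+1}\to M$ such that $T(\underline{a})_k=\varphi\big(a_{(2\ell+1)k-\ell-r},a_{(2\ell+1)k-\ell-r+1},\ldots,a_{(2\ell+1)k+\ell+r}\big)$ for every $\underline{a}\in M^{\mathbb{Z}}$ and $k\in\mathbb{Z}$. The map $\varphi$ is called the local rule of $T$, and $T$ is called simple when $r=0$, in which case $T(\underline{a})_k=\varphi(a_{(2\ell+1)k-\ell},\ldots,a_{(2\ell+1)k+\ell})$. A positional symmetry of a map $\varphi\colon M^n\to M$ is a permutation $\pi$ of $\{1,\ldots,n\}$ such that $\varphi(a_{\pi(1)},\ldots,a_{\pi(n)})=\varphi(a_1,\ldots,a_n)$ for all $a_1,\ldots,a_n\in M$; it moves the $i$th argument if $\pi(i)\ne i$. The trace of $\underline{a}\in M^{\mathbb{Z}}$ under $T$ is the sequence $\underline{a}^T:=(T^n(\underline{a})_0)_{n\in\mathbb{N}_0}\in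 M^{\mathbb{N}_0}$, where $\mathbb{N}_0=\{0,1,2,\ldots\}$. A tail event $E\subseteq M^{\mathbb{N}_0}$ is an element of the tail $\sigma$-algebra of $M^{\mathbb{N}_0}$, i.e. for every $m$ the event $E$ is measurably determined by the coordinates with index $\ge m$. *)

theory Defs
  imports "HOL-Probability.Probability" "HOL-Combinatorics.Permutations"
begin

text \<open>
  A measurable space is a \<^typ>\<open>'a measure\<close> of which only the underlying set and the
  sigma-algebra are used. The power \<open>M\<^sup>n\<close> is the product \<open>PiM {1..n} (\<lambda>_. M)\<close>, so
  arguments are numbered from \<open>1\<close> to \<open>n\<close>; \<open>M\<close> to the power of the integers is
  \<open>PiM UNIV (\<lambda>_. M)\<close>.
\<close>

text \<open>
  Argument \<open>i\<close> of the local rule is the entry at position \<open>(2l+1)k - l - r + (i - 1)\<close>. The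
  equation constrains \<open>T\<close> only on sequences with entries in \<open>space M\<close>, and there it implies
  that \<open>T a\<close> has entries in \<open>space M\<close> again.
\<close>

definition renormalization_map ::
    "'a measure \<Rightarrow> nat \<Rightarrow> nat \<Rightarrow> ((nat \<Rightarrow> 'a) \<Rightarrow> 'a) \<Rightarrow> ((int \<Rightarrow> 'a) \<Rightarrow> int \<Rightarrow> 'a) \<Rightarrow> bool" where
  "renormalization_map M l r \<phi> T \<longleftrightarrow>
     \<phi> \<in> measurable (PiM {1..2*l+2*r+1} (\<lambda>_. M)) M \<and>
     (\<forall>a \<in> space (PiM UNIV (\<lambda>_. M)). \<forall>k.
        T a k = \<phi> (\<lambda>i\<in>{1..2*l+2*r+1}. a ((2 * int l + 1) * k - int l - int r + (int i - 1))))"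

definition simple_renormalization_map ::
    "'a measure \<Rightarrow> nat \<Rightarrow> ((nat \<Rightarrow> 'a) \<Rightarrow> 'a) \<Rightarrow> ((int \<Rightarrow> 'a) \<Rightarrow> int \<Rightarrow> 'a) \<Rightarrow> bool" where
  "simple_renormalization_map M l \<phi> T \<longleftrightarrow> renormalization_map M l 0 \<phi> T"

definition positional_symmetry ::
    "'a measure \<Rightarrow> nat \<Rightarrow> ((nat \<Rightarrow> 'a) \<Rightarrow> 'a) \<Rightarrow> (nat \<Rightarrow> nat) \<Rightarrow> bool" where
  "positional_symmetry M n \<phi> \<pi> \<longleftrightarrow>
     \<pi> permutes {1..n} \<and>
     (\<forall>a \<in> space (PiM {1..n} (\<lambda>_. M)). \<phi> (\<lambda>i\<in>{1..n}. a (\<pi> i)) = \<phi> a)"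

definition renorm_trace :: "((int \<Rightarrow> 'a) \<Rightarrow> int \<Rightarrow> 'a) \<Rightarrow> (int \<Rightarrow> 'a) \<Rightarrow> nat \<Rightarrow> 'a" where
  "renorm_trace T a = (\<lambda>n. (T ^^ n) a 0)"

text \<open>
  The \<open>m\<close>-th set in the intersection consists of the events of the form
  \<open>{x. restrict x {m..} \<in> B}\<close> with \<open>B\<close> measurable in the product over the indices \<open>\<ge> m\<close>.
  The library's \<open>tail_events\<close> is not used because it lives in the context of a probability
  measure, whereas here the sequence space carries none.
\<close>

definition tail_sigma_algebra :: "'a measure \<Rightarrow> (nat \<Rightarrow> 'a) set set" where
  "tail_sigma_algebra M =
     (\<Inter>m. sets (vimage_algebra (space (PiM UNIV (\<lambda>_. M))) (\<lambda>x. restrict x {m..})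
                  (PiM {m..} (\<lambda>_. M))))"

end

theory Submission imports Defs begin

text \<open>
  The argument is that of the Hewitt--Savage zero-one law. Write \<open>N = 2l + 1\<close>. The entry
  \<open>T\<^sup>n(a)\<^sub>q\<close> depends only on the \<open>q\<close>-th block of length \<open>N\<^sup>n\<close> of \<open>a\<close>. Permuting the \<open>N\<close>
  innermost such blocks according to the symmetry of the local rule changes \<open>T\<^sup>n(a)\<close> but not
  \<open>T\<^sup>n\<^sup>+\<^sup>1(a)\<close>, so a tail event of the trace is invariant under all these permutations \<open>s\<^sub>n\<close> of the
  integers. As the central argument is moved, \<open>s\<^sub>n\<close> maps the central block off itself, and
  hence, for large \<open>n\<close>, any given finite set off any other one. A product measure is mixing
  along such a sequence, so an invariant event is independent of itself.
\<close>

section \<open>Extending asymptotic independence from a pi-system\<close>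

text \<open>The sets \<open>A\<close> with this limit form a Dynkin system containing the pi-system
  \<open>G\<close>: complements rest on \<open>prob (B n)\<close> tending to \<open>c\<close>,
  disjoint unions on dominated convergence of series.\<close>

lemma (in prob_space) asymptotic_indep_sigma_sets:
  assumes G: "Int_stable G" "G \<subseteq> Pow (space M)" "sets M = sigma_sets (space M) G"
    and B: "\<And>n. B n \<in> events" and c: "(\<lambda>n. prob (B n)) \<longlonglongrightarrow> c"
    and gen: "\<And>A. A \<in> G \<Longrightarrow> (\<lambda>n. prob (A \<inter> B n)) \<longlonglongrightarrow> prob A * c"
    and A: "A \<in> events"
  shows "(\<lambda>n. prob (A \<inter> B n)) \<longlonglongrightarrow> prob A * c"
proof -
  from A have "A \<in> sigma_sets (space M) G"
    using G by simp
  with G(1,2) show ?thesis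
  proof (induction rule: sigma_sets_induct_disjoint)
    case (basic A)
    then show ?case by (rule gen)
  next
    case empty
    then show ?case by simp
  next
    case (compl A)
    have A: "A \<in> events"
      using compl G by simp
    have "prob ((space M - A) \<inter> B n) = prob (B n) - prob (A \<inter> B n)" for n
    proof -
      have "(space M - A) \<inter> B n = B n - A \<inter> B n"
        using sets.sets_into_space[OF B] by auto
      then show ?thesis
        using A B by (simp add: finite_measure_Diff)
    qed
    moreover have "(\<lambda>n. prob (B n) - prob (A \<inter> B n)) \<longlonglongrightarrow> c - prob A * c"
      by (intro tendsto_diff c compl)
    moreover have "c - prob A * c = prob (space M - A) * c"
      using A by (simp add: prob_compl algebra_simps)
    ultimately show ?case by simp
  next
    case (union A)
    have A: "range A \<subseteq> events"
      using union G by auto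
    have sums: "(\<lambda>i. prob (A i)) sums prob (\<Union>i. A i)"
      by (rule finite_measure_UNION[OF A union(1)])
    \<comment> \<open>Limit and sum may be exchanged because \<open>prob (A i)\<close> dominates
      term \<open>i\<close> for every \<open>n\<close> and is summable by disjointness.\<close>
    have "(\<lambda>n. \<Sum>i. prob (A i \<inter> B n)) \<longlonglongrightarrow> (\<Sum>i. prob (A i) * c)"
    proof (rule tannerys_theorem[THEN conjunct2, THEN conjunct2])
      show "\<And>k. (\<lambda>n. prob (A k \<inter> B n)) \<longlonglongrightarrow> prob (A k) * c"
        by (rule union)
      show "\<forall>\<^sub>F (k, n) in sequentially \<times>\<^sub>F sequentially. norm (prob (A k \<inter> B n)) \<le> prob (A k)"
        using A by (intro always_eventually) (auto intro!: finite_measure_mono)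
      show "summable (\<lambda>i. prob (A i))"
        using sums by (rule sums_summable)
    qed simp
    moreover have "(\<Sum>i. prob (A i \<inter> B n)) = prob ((\<Union>i. A i) \<inter> B n)" for n
    proof -
      have "(\<lambda>i. prob (A i \<inter> B n)) sums prob (\<Union>i. A i \<inter> B n)"
        using A B union(1)
        by (intro finite_measure_UNION) (auto simp: disjoint_family_on_def, blast)
      then show ?thesis
        by (simp add: sums_iff)
    qed
    moreover have "(\<Sum>i. prob (A i) * c) = prob (\<Union>i. A i) * c"
      using sums_mult2[OF sums, of c] by (simp add: sums_iff)
    ultimately show ?case by simp
  qed
qed

section \<open>Rectangles and reindexing in product measures\<close>

lemma measurable_reindex_PiM:
  "(\<lambda>a. a \<circ> s) \<in> measurable (PiM UNIV (\<lambda>_. M)) (PiM UNIV (\<lambda>_. M))"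
  unfolding comp_def by (intro measurable_PiM_single') (auto simp: space_PiM)

lemma comp_in_space_PiM:
  "a \<in> space (PiM UNIV (\<lambda>_. M)) \<Longrightarrow> a \<circ> s \<in> space (PiM UNIV (\<lambda>_. M))"
  by (auto simp: space_PiM)

text \<open>The sides are extended by \<open>{}\<close> to a total family \<open>F\<close>, so that
  their measurability carries no side condition when two rectangles are merged.\<close>

lemma prod_algebra_UNIV_rectangle:
  assumes "A \<in> prod_algebra UNIV (\<lambda>_. M)"
  shows "\<exists>J F. finite J \<and> (\<forall>j. F j \<in> sets M) \<and>
           A = {a \<in> space (PiM UNIV (\<lambda>_. M)). \<forall>j\<in>J. a j \<in> F j}"
proof -
  from prod_algebraE[OF assms] obtain J E where *:
    "A = prod_emb UNIV (\<lambda>_. M) J (Pi\<^sub>E J E)" "finite J" "\<And>i. i \<in> J \<Longrightarrow> E i \<in> sets M"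
    by blast
  define F where "F j = (if j \<in> J then E j else {})" for j
  have "A = {a \<in> space (PiM UNIV (\<lambda>_. M)). \<forall>j\<in>J. a j \<in> F j}"
    unfolding *(1) by (auto simp: prod_emb_def space_PiM F_def)
  moreover have "\<forall>j. F j \<in> sets M"
    using *(3) by (simp add: F_def)
  ultimately show ?thesis
    using *(2) by blast
qed

context
  fixes D :: "'a measure"
  assumes D: "prob_space D"
begin

interpretation D: prob_space D by (rule D)
interpretation product_prob_space "\<lambda>_. D" UNIV
  by unfold_locales

lemma measure_PiM_rectangle:
  assumes "finite J" "\<And>j. j \<in> J \<Longrightarrow> F j \<in> sets D"
  shows "measure (PiM UNIV (\<lambda>_. D)) {a \<in> space (PiM UNIV (\<lambda>_. D)). \<forall>j\<in>J. a j \<in> F j}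
           = (\<Prod>j\<in>J. measure D (F j))"
proof -
  have "{a \<in> space (PiM UNIV (\<lambda>_. D)). \<forall>j\<in>J. a j \<in> F j} = prod_emb UNIV (\<lambda>_. D) J (Pi\<^sub>E J F)"
    by (auto simp: prod_emb_def space_PiM)
  then show ?thesis
    using assms by (simp add: measure_PiM_emb)
qed

text \<open>Distinct coordinates of an i.i.d. family are again i.i.d., so an injective reindexing
  preserves the product measure.\<close>

lemma measure_PiM_reindex_vimage:
  assumes "inj s" "A \<in> sets (PiM UNIV (\<lambda>_. D))"
  shows "measure (PiM UNIV (\<lambda>_. D)) {a \<in> space (PiM UNIV (\<lambda>_. D)). a \<circ> s \<in> A}
           = measure (PiM UNIV (\<lambda>_. D)) A"
proof -
  have "measure (PiM UNIV (\<lambda>_. D)) A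
      = measure (distr (PiM UNIV (\<lambda>_. D)) (PiM UNIV (\<lambda>_. D)) (\<lambda>a. a \<circ> s)) A"
    using distr_PiM_reindex[of UNIV "\<lambda>_. D" s UNIV] assms(1) D by (simp add: comp_def restrict_UNIV)
  also have "\<dots> = measure (PiM UNIV (\<lambda>_. D)) ((\<lambda>a. a \<circ> s) -` A \<inter> space (PiM UNIV (\<lambda>_. D)))"
    by (intro measure_distr measurable_reindex_PiM assms(2))
  also have "(\<lambda>a. a \<circ> s) -` A \<inter> space (PiM UNIV (\<lambda>_. D))
      = {a \<in> space (PiM UNIV (\<lambda>_. D)). a \<circ> s \<in> A}"
    by auto
  finally show ?thesis by simp
qed

text \<open>The second event constrains only coordinates in the image of \<open>K\<close> under
  \<open>s\<close>. This image avoids \<open>J\<close>, so both events together form one rectangle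
  whose measure factors.\<close>

lemma measure_PiM_reindex_rectangles:
  fixes s :: "'i \<Rightarrow> 'i"
  assumes s: "inj s" "s ` K \<inter> J = {}" and J: "finite J" "\<And>j. F j \<in> sets D"
    and K: "finite K" "\<And>k. H k \<in> sets D"
  defines "\<Omega> \<equiv> space (PiM (UNIV :: 'i set) (\<lambda>_. D))"
  shows "measure (PiM UNIV (\<lambda>_. D))
             ({a \<in> \<Omega>. \<forall>j\<in>J. a j \<in> F j} \<inter> {a \<in> \<Omega>. a \<circ> s \<in> {a \<in> \<Omega>. \<forall>k\<in>K. a k \<in> H k}})
           = measure (PiM UNIV (\<lambda>_. D)) {a \<in> \<Omega>. \<forall>j\<in>J. a j \<in> F j} *
             measure (PiM UNIV (\<lambda>_. D)) {a \<in> \<Omega>. \<forall>k\<in>K. a k \<in> H k}"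
proof -
  \<comment> \<open>\<open>L\<close> merges the sides of both rectangles: \<open>inv s\<close> hands
    the side \<open>H k\<close> to position \<open>s k\<close>, where no side \<open>F\<close> is
    prescribed.\<close>
  define L where "L i = (if i \<in> J then F i else H (inv s i))" for i
  have L: "L (s k) = H k" if "k \<in> K" for k
    using that s by (auto simp: L_def)
  have "{a \<in> \<Omega>. \<forall>j\<in>J. a j \<in> F j} \<inter> {a \<in> \<Omega>. a \<circ> s \<in> {a \<in> \<Omega>. \<forall>k\<in>K. a k \<in> H k}}
      = {a \<in> \<Omega>. \<forall>i\<in>J \<union> s ` K. a i \<in> L i}"
    (is "?lhs = ?rhs")
  proof (intro set_eqI)
    fix a
    have "(\<forall>i\<in>J \<union> s ` K. a i \<in> L i) \<longleftrightarrow> (\<forall>j\<in>J. a j \<in> F j) \<and> (\<forall>k\<in>K. a (s k) \<in> H k)"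
      using L by (simp add: ball_Un) (simp add: L_def)
    then show "a \<in> ?lhs \<longleftrightarrow> a \<in> ?rhs"
      using comp_in_space_PiM[of a D s] by (auto simp: \<Omega>_def)
  qed
  also have "measure (PiM UNIV (\<lambda>_. D)) \<dots> = (\<Prod>i\<in>J \<union> s ` K. measure D (L i))"
    unfolding \<Omega>_def using J K by (intro measure_PiM_rectangle) (auto simp: L_def)
  also have "\<dots> = (\<Prod>i\<in>J. measure D (L i)) * (\<Prod>i\<in>s ` K. measure D (L i))"
    using s J K by (intro prod.union_disjoint) auto
  also have "(\<Prod>i\<in>s ` K. measure D (L i)) = (\<Prod>k\<in>K. measure D (H k))"
    using s by (subst prod.reindex) (auto intro: inj_on_subset simp: L)
  also have "(\<Prod>i\<in>J. measure D (L i)) = (\<Prod>i\<in>J. measure D (F i))"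
    by (simp add: L_def)
  also have "(\<Prod>i\<in>J. measure D (F i))
      = measure (PiM UNIV (\<lambda>_. D)) {a \<in> \<Omega>. \<forall>j\<in>J. a j \<in> F j}"
    unfolding \<Omega>_def using J by (simp add: measure_PiM_rectangle)
  also have "(\<Prod>k\<in>K. measure D (H k))
      = measure (PiM UNIV (\<lambda>_. D)) {a \<in> \<Omega>. \<forall>k\<in>K. a k \<in> H k}"
    unfolding \<Omega>_def using K by (simp add: measure_PiM_rectangle)
  finally show ?thesis .
qed

text \<open>Injectivity makes every reindexing measure preserving, and \<open>escape\<close> makes
  any two rectangles independent once one of them is reindexed by \<open>s n\<close> with
  \<open>n\<close> large. Invariance turns this into independence of \<open>A\<close> from every
  rectangle, and then from itself.\<close>

lemma zero_one_law_reindex_invariant: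
  fixes s :: "nat \<Rightarrow> 'i \<Rightarrow> 'i"
  defines "\<Omega> \<equiv> space (PiM (UNIV :: 'i set) (\<lambda>_. D))"
  assumes inj: "\<And>n. inj (s n)"
    and escape: "\<And>J K. finite J \<Longrightarrow> finite K \<Longrightarrow> \<forall>\<^sub>F n in sequentially. s n ` K \<inter> J = {}"
    and A: "A \<in> sets (PiM UNIV (\<lambda>_. D))"
    and inv: "\<And>n a. a \<in> \<Omega> \<Longrightarrow> a \<circ> s n \<in> A \<longleftrightarrow> a \<in> A"
  shows "measure (PiM UNIV (\<lambda>_. D)) A \<in> {0, 1}"
proof -
  let ?G = "prod_algebra (UNIV :: 'i set) (\<lambda>_. D)"
  define \<mu> where "\<mu> = measure (PiM (UNIV :: 'i set) (\<lambda>_. D))"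
  define pre where "pre n B = {a \<in> \<Omega>. a \<circ> s n \<in> B}" for n B
  have G: "Int_stable ?G" "?G \<subseteq> Pow (space (PiM UNIV (\<lambda>_. D)))"
    "sets (PiM UNIV (\<lambda>_. D)) = sigma_sets (space (PiM UNIV (\<lambda>_. D))) ?G"
    unfolding space_PiM
    by (rule Int_stable_prod_algebra prod_algebra_sets_into_space sets_PiM)+
  have G_sets: "B \<in> sets (PiM UNIV (\<lambda>_. D))" if "B \<in> ?G" for B
    unfolding G(3) using that by (rule sigma_sets.Basic)
  have pre_sets: "pre n B \<in> sets (PiM UNIV (\<lambda>_. D))" if "B \<in> sets (PiM UNIV (\<lambda>_. D))" for n B
  proof -
    have "pre n B = (\<lambda>a. a \<circ> s n) -` B \<inter> space (PiM UNIV (\<lambda>_. D))"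
      by (auto simp: pre_def \<Omega>_def)
    also have "\<dots> \<in> sets (PiM UNIV (\<lambda>_. D))"
      by (rule measurable_sets[OF measurable_reindex_PiM that])
    finally show ?thesis .
  qed
  have mu_pre: "\<mu> (pre n B) = \<mu> B" if "B \<in> sets (PiM UNIV (\<lambda>_. D))" for n B
    unfolding \<mu>_def pre_def \<Omega>_def by (rule measure_PiM_reindex_vimage[OF inj that])
  \<comment> \<open>The invariance of \<open>A\<close> makes the sequence \<open>\<mu> (A \<inter> pre n B)\<close> constant, so that mixing is only
    needed for rectangles \<open>B\<close>.\<close>
  have indep: "\<mu> (B \<inter> A) = \<mu> B * \<mu> A" if B: "B \<in> ?G" for B
  proof -
    have mixing: "(\<lambda>n. \<mu> (C \<inter> pre n B)) \<longlonglongrightarrow> \<mu> C * \<mu> B" if C: "C \<in> ?G" for C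
    proof (rule tendsto_eventually)
      from prod_algebra_UNIV_rectangle[OF C, folded \<Omega>_def] obtain J F where
        "finite J \<and> (\<forall>j. F j \<in> sets D) \<and> C = {a \<in> \<Omega>. \<forall>j\<in>J. a j \<in> F j}"
        by (elim exE)
      then have J: "finite J" "\<And>j. F j \<in> sets D" "C = {a \<in> \<Omega>. \<forall>j\<in>J. a j \<in> F j}"
        by simp_all
      from prod_algebra_UNIV_rectangle[OF B, folded \<Omega>_def] obtain K H where
        "finite K \<and> (\<forall>j. H j \<in> sets D) \<and> B = {a \<in> \<Omega>. \<forall>k\<in>K. a k \<in> H k}"
        by (elim exE)
      then have K: "finite K" "\<And>j. H j \<in> sets D" "B = {a \<in> \<Omega>. \<forall>k\<in>K. a k \<in> H k}"
        by simp_all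
      show "\<forall>\<^sub>F n in sequentially. \<mu> (C \<inter> pre n B) = \<mu> C * \<mu> B"
        using escape[OF J(1) K(1)]
      proof eventually_elim
        case (elim n)
        show ?case
          unfolding \<mu>_def pre_def J(3) K(3) \<Omega>_def
          by (rule measure_PiM_reindex_rectangles[OF inj elim J(1,2) K(1,2)])
      qed
    qed
    have "(\<lambda>n. \<mu> (pre n B)) \<longlonglongrightarrow> \<mu> B"
      by (simp only: mu_pre[OF G_sets[OF B]] tendsto_const)
    then have "(\<lambda>n. \<mu> (A \<inter> pre n B)) \<longlonglongrightarrow> \<mu> A * \<mu> B"
      using mixing unfolding \<mu>_def
      by (rule asymptotic_indep_sigma_sets[OF G pre_sets[OF G_sets[OF B]] _ _ A])
    moreover have "\<mu> (A \<inter> pre n B) = \<mu> (A \<inter> B)" for n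
    proof -
      have "\<mu> (A \<inter> pre n B) = \<mu> (pre n (A \<inter> B))"
        using sets.sets_into_space[OF A] inv
        by (intro arg_cong[of _ _ \<mu>]) (auto simp: pre_def \<Omega>_def)
      also have "\<dots> = \<mu> (A \<inter> B)"
        by (intro mu_pre sets.Int A G_sets B)
      finally show ?thesis .
    qed
    ultimately show ?thesis
      by (simp add: LIMSEQ_const_iff Int_commute mult.commute)
  qed
  \<comment> \<open>Independence from all rectangles extends to every measurable set, by the same
    lemma with the constant sequence \<open>A\<close>. Taking \<open>A\<close> itself leaves
    \<open>\<mu> A = \<mu> A * \<mu> A\<close>.\<close>
  have "(\<lambda>n::nat. \<mu> (A \<inter> A)) \<longlonglongrightarrow> \<mu> A * \<mu> A"
    unfolding \<mu>_def
    by (rule asymptotic_indep_sigma_sets[OF G, where B = "\<lambda>_. A"])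
       (simp_all only: A indep[unfolded \<mu>_def] tendsto_const)
  then have "\<mu> (A \<inter> A) = \<mu> A * \<mu> A"
    by (rule LIMSEQ_const_iff[THEN iffD1])
  moreover have "\<mu> A * (\<mu> A - 1) = \<mu> A * \<mu> A - \<mu> (A \<inter> A)"
    by (simp add: right_diff_distrib)
  ultimately have "\<mu> A * (\<mu> A - 1) = 0"
    by linarith
  then show ?thesis
    by (auto simp: \<mu>_def)
qed

end

section \<open>Lifting reindexings through blocks of integers\<close>

text \<open>
  The integers are cut into the blocks \<open>{(2l+1)q - l..(2l+1)q + l}\<close>, and \<open>lift_blocks l s\<close>
  translates block \<open>q\<close> onto block \<open>s q\<close>.
\<close>

definition lift_blocks :: "nat \<Rightarrow> (int \<Rightarrow> int) \<Rightarrow> int \<Rightarrow> int" where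
  "lift_blocks l s k =
     (2 * int l + 1) * s ((k + int l) div (2 * int l + 1)) + ((k + int l) mod (2 * int l + 1) - int l)"

text \<open>Adding \<open>l\<close> moves the start of block \<open>q\<close> to
  \<open>(2l+1)q\<close>, so quotient and remainder are the block number and the offset within the
  block.\<close>

lemma lift_blocks_div_mod:
  "(lift_blocks l s k + int l) div (2 * int l + 1) = s ((k + int l) div (2 * int l + 1))"
  "(lift_blocks l s k + int l) mod (2 * int l + 1) = (k + int l) mod (2 * int l + 1)"
  by (simp_all add: lift_blocks_def)

lemma inj_lift_blocks:
  assumes "inj s"
  shows "inj (lift_blocks l s)"
proof (rule injI)
  fix j k
  assume "lift_blocks l s j = lift_blocks l s k"
  then have "(j + int l) div (2 * int l + 1) = (k + int l) div (2 * int l + 1)"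
    "(j + int l) mod (2 * int l + 1) = (k + int l) mod (2 * int l + 1)"
    using lift_blocks_div_mod[of l s j] lift_blocks_div_mod[of l s k] injD[OF assms] by auto
  then have "j + int l = k + int l"
    by (metis div_mult_mod_eq)
  then show "j = k" by simp
qed

text \<open>The interval of radius \<open>(2 * int l + 1) * m + int l\<close> about 0 is exactly the
  union of the blocks numbered from \<open>- m\<close> to \<open>m\<close>, so escape of block
  numbers is escape of positions.\<close>

lemma lift_blocks_escape:
  assumes s: "\<And>k. \<bar>k\<bar> \<le> m \<Longrightarrow> \<bar>s k\<bar> > m" and k: "\<bar>k\<bar> \<le> (2 * int l + 1) * m + int l"
  shows "\<bar>lift_blocks l s k\<bar> > (2 * int l + 1) * m + int l"
proof -
  have block: "\<bar>j\<bar> \<le> (2 * int l + 1) * m + int l \<longleftrightarrow> \<bar>(j + int l) div (2 * int l + 1)\<bar> \<le> m" for j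
  proof -
    define N q where "N = 2 * int l + 1" and "q = (j + int l) div N"
    have j: "j + int l = N * q + (j + int l) mod N"
      by (simp add: q_def)
    have "0 \<le> (j + int l) mod N" "(j + int l) mod N < N"
      using pos_mod_bound[of N "j + int l"] by (simp_all add: N_def)
    with j have bounds: "N * q \<le> j + int l" "j + int l < N * q + N"
      by linarith+
    have mono: "N * x \<le> N * y" if "x \<le> y" for x y
      using that by (intro mult_left_mono) (simp_all add: N_def)
    have "\<bar>j\<bar> \<le> N * m + int l \<longleftrightarrow> \<bar>q\<bar> \<le> m"
    proof
      assume "\<bar>q\<bar> \<le> m"
      then have "N * q \<le> N * m" "N * (- m) \<le> N * q"
        using mono[of q m] mono[of "- m" q] by auto
      then have "N * q \<le> N * m" "- (N * m) \<le> N * q"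
        by simp_all
      then show "\<bar>j\<bar> \<le> N * m + int l"
        using bounds N_def by linarith
    next
      assume *: "\<bar>j\<bar> \<le> N * m + int l"
      show "\<bar>q\<bar> \<le> m"
      proof (rule ccontr)
        assume "\<not> \<bar>q\<bar> \<le> m"
        then have "m + 1 \<le> q \<or> q \<le> - m - 1"
          by linarith
        then have "N * (m + 1) \<le> N * q \<or> N * q \<le> N * (- m - 1)"
          using mono by blast
        then have "N * m + N \<le> N * q \<or> N * q \<le> - (N * m) - N"
          by (simp add: distrib_left right_diff_distrib)
        then show False
          using * bounds N_def by linarith
      qed
    qed
    then show ?thesis by (simp add: N_def q_def)
  qed
  show ?thesis
    using s[of "(k + int l) div (2 * int l + 1)"] k block[of k] block[of "lift_blocks l s k"]
    by (simp add: lift_blocks_div_mod)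
qed

text \<open>The radius starts at 0, where \<open>s 0 \<noteq> 0\<close> is the claim, and each lift
  replaces \<open>m\<close> by \<open>(2l+1)m + l\<close>. As \<open>l > 0\<close>, it grows by at
  least 1 each time, whence \<open>m \<ge> int n\<close>.\<close>

lemma funpow_lift_blocks_escape:
  assumes "l > 0" "s 0 \<noteq> 0"
  shows "\<exists>m \<ge> int n. \<forall>k. \<bar>k\<bar> \<le> m \<longrightarrow> \<bar>(lift_blocks l ^^ n) s k\<bar> > m"
proof (induction n)
  case 0
  then show ?case using assms by (intro exI[of _ 0]) auto
next
  case (Suc n)
  then obtain m where m: "m \<ge> int n" "\<And>k. \<bar>k\<bar> \<le> m \<Longrightarrow> \<bar>(lift_blocks l ^^ n) s k\<bar> > m"
    by blast
  have "int l * m \<ge> 0"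
    using m(1) by simp
  moreover have "(2 * int l + 1) * m + int l = m + int l + 2 * (int l * m)"
    by (simp add: algebra_simps)
  ultimately have "(2 * int l + 1) * m + int l \<ge> int (Suc n)"
    using m(1) assms(1) by linarith
  moreover have "\<bar>(lift_blocks l ^^ Suc n) s k\<bar> > (2 * int l + 1) * m + int l"
    if "\<bar>k\<bar> \<le> (2 * int l + 1) * m + int l" for k
    using lift_blocks_escape[OF m(2) that] by simp
  ultimately show ?case by blast
qed

text \<open>Once \<open>n\<close> reaches a common bound for \<open>J\<close> and \<open>K\<close>,
  both lie in an interval that the \<open>n\<close>-fold lift maps off itself.\<close>

lemma funpow_lift_blocks_eventually_disjoint:
  assumes "l > 0" "s 0 \<noteq> 0" "finite J" "finite K"
  shows "\<forall>\<^sub>F n in sequentially. (lift_blocks l ^^ n) s ` K \<inter> J = {}"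
proof -
  obtain b where b: "\<And>k. k \<in> J \<union> K \<Longrightarrow> \<bar>k\<bar> \<le> b"
    using assms(3,4) bdd_above_finite[of "abs ` (J \<union> K)"] by (auto simp: bdd_above_def)
  show ?thesis
    using eventually_ge_at_top[of "nat b"]
  proof eventually_elim
    case (elim n)
    obtain m where m: "m \<ge> int n" "\<And>k. \<bar>k\<bar> \<le> m \<Longrightarrow> \<bar>(lift_blocks l ^^ n) s k\<bar> > m"
      using funpow_lift_blocks_escape[of l s n] assms(1,2) by blast
    have bm: "b \<le> m"
      using m(1) elim by linarith
    have "(lift_blocks l ^^ n) s k \<notin> J" if "k \<in> K" for k
    proof
      assume "(lift_blocks l ^^ n) s k \<in> J"
      then have "\<bar>(lift_blocks l ^^ n) s k\<bar> \<le> m" "\<bar>k\<bar> \<le> m"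
        using b[of k] b[of "(lift_blocks l ^^ n) s k"] bm that by simp_all
      then show False
        using m(2)[of k] by linarith
    qed
    then show ?case by blast
  qed
qed

section \<open>Measurability and equivariance of the renormalization map\<close>

context
  fixes M :: "'a measure" and l :: nat and \<phi> T
  assumes T: "simple_renormalization_map M l \<phi> T"
begin

lemma local_rule_measurable: "\<phi> \<in> measurable (PiM {1..2*l+1} (\<lambda>_. M)) M"
  using T by (simp add: simple_renormalization_map_def renormalization_map_def)

lemma renormalization_apply:
  assumes "a \<in> space (PiM UNIV (\<lambda>_. M))"
  shows "T a k = \<phi> (\<lambda>i\<in>{1..2*l+1}. a ((2 * int l + 1) * k - int l + (int i - 1)))"
  using T assms by (simp add: simple_renormalization_map_def renormalization_map_def)

lemma renormalization_measurable:
  "T \<in> measurable (PiM UNIV (\<lambda>_. M)) (PiM UNIV (\<lambda>_. M))"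
proof -
  have "(\<lambda>a k. \<phi> (\<lambda>i\<in>{1..2*l+1}. a ((2 * int l + 1) * k - int l + (int i - 1))))
      \<in> measurable (PiM UNIV (\<lambda>_. M)) (PiM UNIV (\<lambda>_. M))"
  proof (rule measurable_PiM_single')
    show *: "(\<lambda>a. \<phi> (\<lambda>i\<in>{1..2*l+1}. a ((2 * int l + 1) * k - int l + (int i - 1))))
        \<in> measurable (PiM UNIV (\<lambda>_. M)) M" for k
      by (intro measurable_compose[OF _ local_rule_measurable] measurable_restrict
          measurable_component_singleton) simp
    show "(\<lambda>a k. \<phi> (\<lambda>i\<in>{1..2*l+1}. a ((2 * int l + 1) * k - int l + (int i - 1))))
        \<in> space (PiM UNIV (\<lambda>_. M)) \<rightarrow> (\<Pi>\<^sub>E i\<in>UNIV. space M)"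
      by (intro funcsetI PiE_I measurable_space[OF *]) simp_all
  qed
  \<comment> \<open>The formula for \<open>T\<close> is known only on the product space, so
    measurability is transferred from the explicit map by agreement there.\<close>
  then show ?thesis
    by (rule measurable_cong[THEN iffD1, rotated]) (simp add: renormalization_apply fun_eq_iff)
qed

lemmas renormalization_in_space = measurable_space[OF renormalization_measurable]

lemma funpow_renormalization_measurable:
  "T ^^ n \<in> measurable (PiM UNIV (\<lambda>_. M)) (PiM UNIV (\<lambda>_. M))"
proof (induction n)
  case (Suc n)
  then show ?case
    using measurable_comp[OF Suc renormalization_measurable] by (simp add: comp_def)
qed (simp add: id_def)

lemma renorm_trace_measurable:
  "renorm_trace T \<in> measurable (PiM UNIV (\<lambda>_. M)) (PiM UNIV (\<lambda>_. M))"
proof -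
  have *: "(\<lambda>a. (T ^^ n) a 0) \<in> measurable (PiM UNIV (\<lambda>_. M)) M" for n
    using measurable_compose[OF funpow_renormalization_measurable measurable_component_singleton]
    by simp
  have "(\<lambda>a n. (T ^^ n) a 0) \<in> measurable (PiM UNIV (\<lambda>_. M)) (PiM UNIV (\<lambda>_. M))"
    by (rule measurable_PiM_single') (auto intro: * measurable_space[OF *])
  moreover have "renorm_trace T = (\<lambda>a n. (T ^^ n) a 0)"
    by (simp add: fun_eq_iff renorm_trace_def)
  ultimately show ?thesis by simp
qed

text \<open>Entry \<open>k\<close> on the left reads block \<open>k\<close> of the reindexed
  sequence, which is block \<open>s k\<close> of \<open>a\<close> in unchanged order.\<close>

lemma renormalization_lift_blocks:
  assumes "a \<in> space (PiM UNIV (\<lambda>_. M))"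
  shows "T (a \<circ> lift_blocks l s) = T a \<circ> s"
proof
  fix k
  have "lift_blocks l s ((2 * int l + 1) * k - int l + (int i - 1))
      = (2 * int l + 1) * s k - int l + (int i - 1)" if "i \<in> {1..2*l+1}" for i
  proof -
    have "(2 * int l + 1) * k - int l + (int i - 1) + int l = (2 * int l + 1) * k + (int i - 1)"
      by simp
    \<comment> \<open>The offset \<open>int i - 1\<close> runs from 0 to \<open>2l\<close> and is
      therefore a genuine remainder modulo \<open>2l+1\<close>.\<close>
    moreover have "((2 * int l + 1) * k + (int i - 1)) div (2 * int l + 1) = k"
      "((2 * int l + 1) * k + (int i - 1)) mod (2 * int l + 1) = int i - 1"
      using that by auto
    ultimately show ?thesis
      by (simp add: lift_blocks_def)
  qed
  then show "T (a \<circ> lift_blocks l s) k = (T a \<circ> s) k"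
    using assms by (simp add: renormalization_apply comp_in_space_PiM cong: restrict_cong)
qed

text \<open>The first application of \<open>T\<close> undoes the outermost lift, and the remaining
  ones act on \<open>T a\<close>; hence the induction over arbitrary \<open>a\<close>.\<close>

lemma funpow_renormalization_lift_blocks:
  assumes "a \<in> space (PiM UNIV (\<lambda>_. M))"
  shows "(T ^^ n) (a \<circ> (lift_blocks l ^^ n) s) = (T ^^ n) a \<circ> s"
  using assms
proof (induction n arbitrary: a)
  case (Suc n)
  have "(T ^^ Suc n) (a \<circ> (lift_blocks l ^^ Suc n) s)
      = (T ^^ n) (T a \<circ> (lift_blocks l ^^ n) s)"
    using renormalization_lift_blocks[OF Suc.prems] by (subst funpow_Suc_right) simp
  also have "\<dots> = (T ^^ n) (T a) \<circ> s"
    by (intro Suc.IH renormalization_in_space Suc.prems)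
  also have "(T ^^ n) (T a) = (T ^^ Suc n) a"
    by (subst funpow_Suc_right) simp
  finally show ?case .
qed simp

end

section \<open>The symmetry acting on the central block\<close>

text \<open>
  Argument \<open>i\<close> of the local rule for the entry \<open>0\<close> sits at position \<open>i - l - 1\<close>. The guard only
  excludes positions at which \<^term>\<open>nat\<close> would truncate; a permutation of
  \<open>{1..2*l+1}\<close> fixes everything else outside the central block.
\<close>

definition central_block_perm :: "nat \<Rightarrow> (nat \<Rightarrow> nat) \<Rightarrow> int \<Rightarrow> int" where
  "central_block_perm l \<pi> q =
     (if q + int l + 1 \<ge> 0 then int (\<pi> (nat (q + int l + 1))) - int l - 1 else q)"

text \<open>The two branches cannot collide: the guarded one takes values at least
  \<open>- l - 1\<close>, the other one smaller values.\<close>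

lemma inj_central_block_perm:
  assumes "inj \<pi>"
  shows "inj (central_block_perm l \<pi>)"
  by (rule injI) (auto simp: central_block_perm_def split: if_splits dest!: injD[OF assms])

text \<open>Entry 0 reads the central block, whose rearrangement the symmetry absorbs; every other
  entry reads a block that stays fixed pointwise.\<close>

lemma renormalization_central_block_perm:
  assumes T: "simple_renormalization_map M l \<phi> T" and \<pi>: "positional_symmetry M (2*l+1) \<phi> \<pi>"
    and a: "a \<in> space (PiM UNIV (\<lambda>_. M))"
  shows "T (a \<circ> central_block_perm l \<pi>) = T a"
proof
  fix k
  let ?c = "central_block_perm l \<pi>"
  have perm: "\<pi> permutes {1..2*l+1}"
    using \<pi> by (simp add: positional_symmetry_def)
  show "T (a \<circ> ?c) k = T a k"
  proof (cases "k = 0")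
    case True
    define b where "b = (\<lambda>i\<in>{1..2*l+1}. a (int i - int l - 1))"
    have b: "b \<in> space (PiM {1..2*l+1} (\<lambda>_. M))"
      using a by (auto simp: b_def space_PiM)
    have "(\<lambda>i\<in>{1..2*l+1}. (a \<circ> ?c) (- int l + (int i - 1))) = (\<lambda>i\<in>{1..2*l+1}. b (\<pi> i))"
    proof (rule restrict_ext)
      fix i assume i: "i \<in> {1..2*l+1}"
      then have "\<pi> i \<in> {1..2*l+1}"
        using permutes_in_image[OF perm] by blast
      then show "(a \<circ> ?c) (- int l + (int i - 1)) = b (\<pi> i)"
        using i by (simp add: b_def central_block_perm_def)
    qed
    moreover have "\<phi> (\<lambda>i\<in>{1..2*l+1}. b (\<pi> i)) = \<phi> b"
      using \<pi> b by (simp add: positional_symmetry_def)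
    moreover have "b = (\<lambda>i\<in>{1..2*l+1}. a (- int l + (int i - 1)))"
      unfolding b_def by (rule restrict_ext) (simp add: algebra_simps)
    ultimately show ?thesis
      using True a by (simp add: renormalization_apply[OF T] comp_in_space_PiM)
  next
    case False
    have "?c ((2 * int l + 1) * k - int l + (int i - 1)) = (2 * int l + 1) * k - int l + (int i - 1)"
      if i: "i \<in> {1..2*l+1}" for i
    proof -
      have "k \<ge> 1 \<or> k \<le> - 1"
        using False by auto
      moreover define t where "t = (2 * int l + 1) * k"
      ultimately have "t \<ge> 2 * int l + 1 \<or> t \<le> - (2 * int l + 1)"
        using mult_left_mono[of 1 k "2 * int l + 1"] mult_left_mono[of k "-1" "2 * int l + 1"] by auto
      \<comment> \<open>The number passed to \<open>\<pi>\<close> would be \<open>t + int i\<close>,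
        which is at least \<open>2l+2\<close> or at most 0. The value 0 still passes the guard, but
        \<open>\<pi>\<close> fixes it.\<close>
      then have "nat (t - int l + (int i - 1) + int l + 1) \<notin> {1..2*l+1}"
        using i by (auto simp: nat_le_iff)
      then show ?thesis
        using permutes_not_in[OF perm] by (simp add: central_block_perm_def t_def)
    qed
    then show ?thesis
      using a by (simp add: renormalization_apply[OF T] comp_in_space_PiM cong: restrict_cong)
  qed
qed

section \<open>Tail events of the trace\<close>

text \<open>For the given \<open>m\<close>, the event \<open>E\<close> is a preimage under
  restriction to \<open>{m..}\<close>, and this restriction does not distinguish \<open>x\<close>
  from \<open>y\<close>.\<close>

lemma tail_sigma_algebra_cong:
  assumes E: "E \<in> tail_sigma_algebra M"
    and "x \<in> space (PiM UNIV (\<lambda>_. M))" "y \<in> space (PiM UNIV (\<lambda>_. M))"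
    and "\<And>n. n \<ge> m \<Longrightarrow> x n = y n"
  shows "x \<in> E \<longleftrightarrow> y \<in> E"
proof -
  have "E \<in> sets (vimage_algebra (space (PiM UNIV (\<lambda>_. M))) (\<lambda>x. restrict x {m..})
      (PiM {m..} (\<lambda>_. M)))"
    using E by (simp add: tail_sigma_algebra_def)
  also have "\<dots> = {(\<lambda>x. restrict x {m..}) -` B \<inter> space (PiM UNIV (\<lambda>_. M)) |B.
      B \<in> sets (PiM {m..} (\<lambda>_. M))}"
    by (rule sets_vimage_algebra2) (auto simp: space_PiM PiE_def)
  finally obtain B where "E = (\<lambda>x. restrict x {m..}) -` B \<inter> space (PiM UNIV (\<lambda>_. M))"
    by blast
  moreover have "restrict x {m..} = restrict y {m..}"
    using assms(4) by (intro restrict_ext) simp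
  ultimately show ?thesis
    using assms(2,3) by simp
qed

lemma tail_sigma_algebra_sets:
  assumes "E \<in> tail_sigma_algebra M"
  shows "E \<in> sets (PiM UNIV (\<lambda>_. M))"
proof -
  have "(\<lambda>x. restrict x {0..}) \<in> measurable (PiM UNIV (\<lambda>_. M)) (PiM {0::nat..} (\<lambda>_. M))"
    by (rule measurable_restrict_subset) simp
  then have "sets (vimage_algebra (space (PiM UNIV (\<lambda>_. M))) (\<lambda>x. restrict x {0..})
      (PiM {0::nat..} (\<lambda>_. M))) \<subseteq> sets (PiM UNIV (\<lambda>_. M))"
    by (intro sets_image_in_sets) auto
  moreover have "E \<in> sets (vimage_algebra (space (PiM UNIV (\<lambda>_. M))) (\<lambda>x. restrict x {0..})
      (PiM {0..} (\<lambda>_. M)))"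
    using assms unfolding tail_sigma_algebra_def by blast
  ultimately show ?thesis by blast
qed

text \<open>After \<open>n\<close> steps the reindexing has descended to
  \<open>central_block_perm l \<pi>\<close> acting on \<open>(T ^^ n) a\<close>, and the next step
  absorbs it. The two traces thus agree from index \<open>Suc n\<close> on.\<close>

lemma renorm_trace_tail_invariant:
  assumes T: "simple_renormalization_map M l \<phi> T" and \<pi>: "positional_symmetry M (2*l+1) \<phi> \<pi>"
    and E: "E \<in> tail_sigma_algebra M" and a: "a \<in> space (PiM UNIV (\<lambda>_. M))"
  defines "s \<equiv> \<lambda>n. (lift_blocks l ^^ n) (central_block_perm l \<pi>)"
  shows "renorm_trace T (a \<circ> s n) \<in> E \<longleftrightarrow> renorm_trace T a \<in> E"
proof (rule tail_sigma_algebra_cong[OF E])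
  show "renorm_trace T (a \<circ> s n) \<in> space (PiM UNIV (\<lambda>_. M))"
    "renorm_trace T a \<in> space (PiM UNIV (\<lambda>_. M))"
    using a by (auto intro: measurable_space[OF renorm_trace_measurable[OF T]] comp_in_space_PiM)
  fix m assume "m \<ge> Suc n"
  then obtain j where j: "m = j + Suc n"
    by (metis le_add_diff_inverse2)
  have "(T ^^ Suc n) (a \<circ> s n) = T ((T ^^ n) a \<circ> central_block_perm l \<pi>)"
    using funpow_renormalization_lift_blocks[OF T a] by (simp add: s_def)
  also have "\<dots> = (T ^^ Suc n) a"
    using renormalization_central_block_perm[OF T \<pi>]
      measurable_space[OF funpow_renormalization_measurable[OF T] a] by simp
  finally show "renorm_trace T (a \<circ> s n) m = renorm_trace T a m"
    unfolding renorm_trace_def j by (simp only: funpow_add comp_apply)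
qed

section \<open>Zero-one law for an i.i.d. sequence\<close>

theorem corollary1p2:
  fixes M :: "'a measure" and l :: nat
    and \<phi> :: "(nat \<Rightarrow> 'a) \<Rightarrow> 'a" and T :: "(int \<Rightarrow> 'a) \<Rightarrow> int \<Rightarrow> 'a"
    and P :: "'w measure" and X :: "int \<Rightarrow> 'w \<Rightarrow> 'a"
    and E :: "(nat \<Rightarrow> 'a) set"
  assumes "simple_renormalization_map M l \<phi> T"
    and "\<exists>\<pi>. positional_symmetry M (2*l+1) \<phi> \<pi> \<and> \<pi> (l+1) \<noteq> l+1"
    and "prob_space P"
    and "prob_space.indep_vars P (\<lambda>_. M) X UNIV"
    and "\<And>j k. distr P M (X j) = distr P M (X k)"
    and "E \<in> tail_sigma_algebra M"
  shows "measure P {\<omega> \<in> space P. renorm_trace T (\<lambda>k. X k \<omega>) \<in> E} \<in> {0, 1}"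
proof -
  note T = assms(1)
  obtain \<pi> where \<pi>: "positional_symmetry M (2*l+1) \<phi> \<pi>" "\<pi> (l+1) \<noteq> l+1"
    using assms(2) by blast
  have perm: "\<pi> permutes {1..2*l+1}"
    using \<pi> by (simp add: positional_symmetry_def)
  \<comment> \<open>For \<open>l = 0\<close> the central argument is the only one, and a permutation
    of \<open>{1..1}\<close> fixes it.\<close>
  have l: "l > 0"
    using \<pi>(2) permutes_in_image[OF perm, of 1] by (cases l) auto
  interpret P: prob_space P by fact
  have X: "X k \<in> measurable P M" for k
    using assms(4) by (simp add: P.indep_vars_def)
  \<comment> \<open>The measure carried by \<open>M\<close> is arbitrary; \<open>D\<close> is the
    common law of the \<open>X k\<close> on the same sigma-algebra, with \<open>X 0\<close> as
    representative.\<close>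
  define D where "D = distr P M (X 0)"
  have D: "prob_space D"
    unfolding D_def by (rule P.prob_space_distr[OF X])
  have sets_D [measurable_cong, simp]: "sets D = sets M"
    by (simp add: D_def)
  have sets_PiM_D: "sets (PiM UNIV (\<lambda>_. D)) = sets (PiM UNIV (\<lambda>_. M))"
    by (rule sets_PiM_cong) simp_all
  note space_PiM_D = sets_eq_imp_space_eq[OF sets_PiM_D]
  have Xm: "(\<lambda>\<omega> k. X k \<omega>) \<in> measurable P (PiM UNIV (\<lambda>_. M))"
    using X by (intro measurable_PiM_single') (auto intro: measurable_space[OF X])
  \<comment> \<open>Independence says that the joint law is the product of the marginal laws, here
    all equal to \<open>D\<close>.\<close>
  have "distr P (PiM UNIV (\<lambda>_. M)) (\<lambda>\<omega> k. X k \<omega>) = PiM UNIV (\<lambda>k. distr P M (X k))"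
    using P.indep_vars_iff_distr_eq_PiM[where I = UNIV and X = X and M' = "\<lambda>_. M"] X assms(4)
    by (simp add: restrict_UNIV)
  also have "\<dots> = PiM UNIV (\<lambda>_. D)"
    using assms(5) by (intro PiM_cong) (auto simp: D_def)
  finally have distr: "distr P (PiM UNIV (\<lambda>_. M)) (\<lambda>\<omega> k. X k \<omega>) = PiM UNIV (\<lambda>_. D)" .
  define A where "A = renorm_trace T -` E \<inter> space (PiM UNIV (\<lambda>_. M))"
  have A: "A \<in> sets (PiM UNIV (\<lambda>_. M))"
    unfolding A_def
    by (rule measurable_sets[OF renorm_trace_measurable[OF T] tail_sigma_algebra_sets[OF assms(6)]])
  define s where "s n = (lift_blocks l ^^ n) (central_block_perm l \<pi>)" for n
  have "measure (PiM UNIV (\<lambda>_. D)) A \<in> {0, 1}"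
  proof (rule zero_one_law_reindex_invariant[OF D])
    show "inj (s n)" for n
      unfolding s_def
      by (induction n) (simp_all add: inj_lift_blocks inj_central_block_perm permutes_inj[OF perm])
    \<comment> \<open>Position 0 is argument \<open>l+1\<close>, so moving the central argument is
      what starts the escape to infinity.\<close>
    have "central_block_perm l \<pi> 0 \<noteq> 0"
      using \<pi>(2) by (simp add: central_block_perm_def nat_add_distrib)
    then show "\<forall>\<^sub>F n in sequentially. s n ` K \<inter> J = {}" if "finite J" "finite K" for J K
      unfolding s_def using l that by (intro funpow_lift_blocks_eventually_disjoint)
    show "A \<in> sets (PiM UNIV (\<lambda>_. D))"
      using A by (simp add: sets_PiM_D)
    show "a \<circ> s n \<in> A \<longleftrightarrow> a \<in> A" if "a \<in> space (PiM UNIV (\<lambda>_. D))" for a n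
      using that renorm_trace_tail_invariant[OF T \<pi>(1) assms(6)] comp_in_space_PiM[of a M "s n"]
      by (simp add: A_def s_def space_PiM_D)
  qed
  also have "measure (PiM UNIV (\<lambda>_. D)) A = measure P ((\<lambda>\<omega> k. X k \<omega>) -` A \<inter> space P)"
    unfolding distr[symmetric] by (rule measure_distr[OF Xm A])
  also have "(\<lambda>\<omega> k. X k \<omega>) -` A \<inter> space P
      = {\<omega> \<in> space P. renorm_trace T (\<lambda>k. X k \<omega>) \<in> E}"
    using measurable_space[OF Xm] by (auto simp: A_def)
  finally show ?thesis .
qed

end
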